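(* Let $s$ be a positive integer and let $\Gamma=\{a_{i,j}\colon i=1,\ldots,s,\ j=1,2,\ldots\}$ be a family of complex numbers. Define $L\colon\mathbb{C}[x]^s\to\mathbb{C}[x]$ by $$L(f_1,\ldots,f_s)=\sum_{i=1}^s\sum_{j=1}^\infty a_{i,j}f_i^{(j)},$$ and let $M_\Gamma$ be the set of polynomials $F\in\mathbb{C}[x,y]$ such that $[F]_n=L([F]_{n-s},\ldots,[F]_{n-1})$ for every $n\ge s$. Then $M_\Gamma$ is an L-module of order $s$.
   Context: A submodule (or module) of $\mathbb{C}[x,y]$ is a translation invariant linear subspace of $\mathbb{C}[x,y]$; equivalently, a linear subspace closed under the partial derivatives $\partial/\partial x$ and $\partial/\partial y$. Every $F\in \mathbb{C}[x,y]$ can be written uniquely as $F(x,y)=\sum_{n=0}^\infty f_n(x)\frac{y^n}{n!}$ with $f_n\in \mathbb{C}[x]$ and $f_n=0$ for all large $n$; the coordinate polynomials of $F$ are $[F]_n=f_n$. For a positive integer $s$, a set $M\subset\mathbb{C}[x,y]$ is an L-module of order $s$ if $M$ is a module and, whenever $F\in M$ and $[F]_n=0$ for every $n<s$, then $F=0$. $f^{(j)}$ denotes the $j$-th derivative; the sum defining $L$ has only finitely many nonzero terms for each $(f_1,\ldots,f_s)$. *)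

theory Defs
  imports Complex_Main "HOL-Computational_Algebra.Polynomial"
begin

text \<open>
  A polynomial in two variables over the complex numbers is an element of
  \<open>complex poly poly\<close>: the outer variable is y and the coefficients are polynomials in x.
\<close>

definition eval2 :: "complex poly poly \<Rightarrow> complex \<Rightarrow> complex \<Rightarrow> complex" where
  "eval2 F x y = poly (poly F [:y:]) x"

text \<open>Multiplication by a complex scalar goes through the constant polynomial.\<close>

definition scale2 :: "complex \<Rightarrow> complex poly poly \<Rightarrow> complex poly poly" where
  "scale2 c F = smult [:c:] F"

text \<open>The polynomial F(x + a, y + b).\<close>

definition translate2 :: "complex \<Rightarrow> complex \<Rightarrow> complex poly poly \<Rightarrow> complex poly poly" where
  "translate2 a b F = map_poly (\<lambda>f. pcompose f [:a, 1:]) (pcompose F [:[:b:], 1:])"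

definition translation_invariant :: "complex poly poly set \<Rightarrow> bool" where
  "translation_invariant M \<longleftrightarrow> (\<forall>F\<in>M. \<forall>a b. translate2 a b F \<in> M)"

definition is_submodule :: "complex poly poly set \<Rightarrow> bool" where
  "is_submodule M \<longleftrightarrow> module.subspace scale2 M \<and> translation_invariant M"

text \<open>
  The coordinate polynomials are taken with respect to the basis y^n / n!, so they differ
  from the plain coefficients by the factor n!.
\<close>

definition coord :: "complex poly poly \<Rightarrow> nat \<Rightarrow> complex poly" where
  "coord F n = smult (fact n) (coeff F n)"

definition is_L_module :: "nat \<Rightarrow> complex poly poly set \<Rightarrow> bool" where
  "is_L_module s M \<longleftrightarrow>
     is_submodule M \<and> (\<forall>F\<in>M. (\<forall>n<s. coord F n = 0) \<longrightarrow> F = 0)"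

text \<open>
  Tuples and coefficient families are functions on the natural numbers; only indices i in
  1, ..., s and j at least 1 are used. Here \<open>sum'\<close> adds up the (finitely many) nonzero terms.
\<close>

definition L_op :: "nat \<Rightarrow> (nat \<Rightarrow> nat \<Rightarrow> complex) \<Rightarrow> (nat \<Rightarrow> complex poly) \<Rightarrow> complex poly" where
  "L_op s a f = (\<Sum>i=1..s. sum' (\<lambda>j. smult (a i j) ((pderiv ^^ j) (f i))) {1..})"

text \<open>For i = 1, ..., s the i-th argument is the coordinate polynomial of index n - s + i - 1.\<close>

definition M_Gamma :: "nat \<Rightarrow> (nat \<Rightarrow> nat \<Rightarrow> complex) \<Rightarrow> complex poly poly set" where
  "M_Gamma s a =
     {F. \<forall>n\<ge>s. coord F n = L_op s a (\<lambda>i. coord F (n - s + (i - 1)))}"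

lemma vector_space_scale2: "vector_space scale2"
proof
  show "scale2 (a + b) F = scale2 a F + scale2 b F" for a b F
    by (simp add: scale2_def flip: smult_add_left)
qed (simp_all add: scale2_def smult_add_right mult.commute flip: one_pCons)

lemma eval2_scale2: "eval2 (scale2 c F) x y = c * eval2 F x y"
  by (simp add: eval2_def scale2_def)

lemma eval2_translate2: "eval2 (translate2 a b F) x y = eval2 F (x + a) (y + b)"
proof -
  have *: "poly (poly (map_poly (\<lambda>f. pcompose f [:a, 1:]) G) [:y:]) x = poly (poly G [:y:]) (x + a)"
    for G :: "complex poly poly"
    by (induction G) (simp_all add: map_poly_pCons poly_pcompose add.commute)
  show ?thesis
    by (simp add: eval2_def translate2_def * poly_pcompose add.commute)
qed

lemma eval2_coord: "eval2 F x y = (\<Sum>n\<le>degree F. poly (coord F n) x * (y ^ n / fact n))"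
  unfolding eval2_def coord_def
  by (simp add: poly_altdef[of F] poly_sum)

lemma finite_nonzero_higher_pderiv:
  fixes f :: "complex poly"
  shows "finite {j \<in> A. smult (c j) ((pderiv ^^ j) f) \<noteq> 0}"
proof (rule finite_subset)
  show "{j \<in> A. smult (c j) ((pderiv ^^ j) f) \<noteq> 0} \<subseteq> {..degree f}"
  proof (intro subsetI, rule ccontr)
    fix j assume j: "j \<in> {j \<in> A. smult (c j) ((pderiv ^^ j) f) \<noteq> 0}" "j \<notin> {..degree f}"
    then have "(pderiv ^^ j) f = 0"
      by (intro poly_eqI) (simp add: coeff_higher_pderiv coeff_eq_0)
    with j show False by simp
  qed
qed simp

end

theory Submission
  imports Defs
begin

text \<open>
  The operator \<open>L\<close> is a constant-coefficient differential operator in x, so it is linear and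
  commutes with the substitution \<open>x \<mapsto> x + c\<close>. The recurrence that defines \<open>M_Gamma s a\<close> is
  thus linear, which gives a subspace, and is preserved by translation in x, which acts on every
  coordinate polynomial separately. Translation in y by \<open>b\<close> replaces the coordinate sequence
  \<open>f\<close> by the sequence with entries \<open>\<Sum>\<^sub>m b\<^sup>m / m! \<cdot> f (n + m)\<close>; this is Taylor's formula, because
  \<open>\<partial>/\<partial>y\<close> is the left shift of coordinate sequences (lemma \<open>coord_pcompose_shift\<close>).
  The recurrence has the same form at every index \<open>n \<ge> s\<close>, so each left shift of a solution is a
  solution, and by linearity so is the combination above. Finally, the recurrence computes each
  entry from its \<open>s\<close> predecessors, and so \<open>s\<close> vanishing initial entries force all to vanish.
\<close>

text \<open>
  Cutting off at any common bound on the degrees lets several arguments share one index range;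
  the algebraic laws of \<open>L\<close> are then laws of finite sums.
\<close>

lemma L_op_eq_sum:
  assumes "\<And>i. i \<in> {1..s} \<Longrightarrow> degree (f i) \<le> N"
  shows "L_op s a f = (\<Sum>i=1..s. \<Sum>j=1..N. smult (a i j) ((pderiv ^^ j) (f i)))"
  unfolding L_op_def
proof (rule sum.cong)
  fix i assume i: "i \<in> {1..s}"
  let ?g = "\<lambda>j. smult (a i j) ((pderiv ^^ j) (f i))"
  have zero: "(pderiv ^^ j) (f i) = 0" if "N < j" for j
    using that assms[OF i] by (intro poly_eqI) (simp add: coeff_higher_pderiv coeff_eq_0)
  have "sum' ?g {1..} = sum ?g {j \<in> {1..}. ?g j \<noteq> 0}"
    using finite_nonzero_higher_pderiv[of "{1..}" "a i" "f i"] by (simp add: sum.G_def)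
  also have "\<dots> = (\<Sum>j=1..N. ?g j)"
    using zero by (intro sum.mono_neutral_left) (auto simp flip: not_less)
  finally show "sum' ?g {1..} = (\<Sum>j=1..N. ?g j)" .
qed simp

lemma common_degree_bound:
  fixes f :: "nat \<Rightarrow> 'a::zero poly"
  obtains N where "\<And>i. i \<in> {1..s} \<Longrightarrow> degree (f i) \<le> N"
  using that[of "Max ((\<lambda>i. degree (f i)) ` {1..s})"] by simp

lemma L_op_cong:
  "(\<And>i. i \<in> {1..s} \<Longrightarrow> f i = g i) \<Longrightarrow> L_op s a f = L_op s a g"
  unfolding L_op_def by (intro sum.cong) simp_all

lemma smult_sum_right: "smult c (\<Sum>x\<in>A. f x) = (\<Sum>x\<in>A. smult c (f x))"
  by (induction A rule: infinite_finite_induct) (simp_all add: smult_add_right)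

lemma L_op_0: "L_op s a (\<lambda>i. 0) = 0"
  by (subst L_op_eq_sum[of _ _ 0]) simp_all

lemma L_op_add: "L_op s a (\<lambda>i. f i + g i) = L_op s a f + L_op s a g"
proof -
  obtain M where M: "\<And>i. i \<in> {1..s} \<Longrightarrow> degree (f i) \<le> M"
    by (rule common_degree_bound[of s f]) blast
  obtain N where N: "\<And>i. i \<in> {1..s} \<Longrightarrow> degree (g i) \<le> N"
    by (rule common_degree_bound[of s g]) blast
  have f: "degree (f i) \<le> max M N" and g: "degree (g i) \<le> max M N" if "i \<in> {1..s}" for i
    using M[OF that] N[OF that] by simp_all
  show ?thesis
    by (subst (1 2 3) L_op_eq_sum[of _ _ "max M N"])
      (simp_all add: f g degree_add_le higher_pderiv_add smult_add_right sum.distrib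
        del: max.bounded_iff)
qed

lemma L_op_smult: "L_op s a (\<lambda>i. smult c (f i)) = smult c (L_op s a f)"
proof -
  obtain N where N: "\<And>i. i \<in> {1..s} \<Longrightarrow> degree (f i) \<le> N"
    by (rule common_degree_bound[of s f]) blast
  then have "degree (smult c (f i)) \<le> N" if "i \<in> {1..s}" for i
    using that degree_smult_le order.trans by blast
  with N show ?thesis
    by (subst (1 2) L_op_eq_sum[of _ _ N])
      (simp_all add: higher_pderiv_smult smult_sum_right mult.commute)
qed

lemma L_op_sum: "L_op s a (\<lambda>i. \<Sum>m\<in>A. f m i) = (\<Sum>m\<in>A. L_op s a (f m))"
  by (induction A rule: infinite_finite_induct) (simp_all add: L_op_0 L_op_add)

lemma higher_pderiv_pcompose_shift:
  fixes f :: "'a::{comm_semiring_1,semiring_no_zero_divisors,semiring_char_0} poly"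
  shows "(pderiv ^^ j) (pcompose f [:c, 1:]) = pcompose ((pderiv ^^ j) f) [:c, 1:]"
  by (induction j) (simp_all add: pderiv_pcompose pderiv_pCons)

lemma L_op_pcompose_shift:
  "L_op s a (\<lambda>i. pcompose (f i) [:c, 1:]) = pcompose (L_op s a f) [:c, 1:]"
proof -
  obtain N where N: "\<And>i. i \<in> {1..s} \<Longrightarrow> degree (f i) \<le> N"
    by (rule common_degree_bound[of s f]) blast
  then show ?thesis
    by (subst (1 2) L_op_eq_sum[of _ _ N])
      (simp_all add: degree_pcompose higher_pderiv_pcompose_shift pcompose_sum pcompose_smult)
qed

lemma coeff_shift_power:
  fixes c :: "'a::comm_semiring_1"
  shows "coeff ([:c, 1:] ^ k) n = of_nat (k choose n) * c ^ (k - n)"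
proof (cases "n \<le> k")
  case False
  then have "degree ([:c, 1:] ^ k) < n"
    using degree_power_le[of "[:c, 1:]" k] by simp
  with False show ?thesis
    by (simp add: coeff_eq_0 binomial_eq_0)
qed (simp add: coeff_linear_poly_power)

text \<open>
  Taylor's formula in y: expanding \<open>(y + b)\<^sup>k\<close> turns the factor \<open>n!\<close> of the coordinate and the
  binomial coefficient \<open>k choose n\<close> into \<open>k! / (k - n)!\<close>, and \<open>k!\<close> makes the k-th coefficient
  a coordinate again.
\<close>

lemma coord_pcompose_shift:
  "coord (pcompose F [:[:b:], 1:]) n =
     (\<Sum>m\<le>degree F. smult (b ^ m / fact m) (coord F (n + m)))"
proof -
  let ?N = "degree F"
  let ?g = "\<lambda>k. smult (fact n * of_nat (k choose n) * b ^ (k - n)) (coeff F k)"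
  have "coeff (pcompose F [:[:b:], 1:]) n =
      (\<Sum>k\<le>?N. smult (of_nat (k choose n) * b ^ (k - n)) (coeff F k))"
    by (simp add: pcompose_altdef poly_altdef degree_map_poly coeff_map_poly coeff_sum
        coeff_shift_power of_nat_poly poly_const_pow mult.commute)
  then have "coord (pcompose F [:[:b:], 1:]) n = (\<Sum>k\<le>?N. ?g k)"
    by (simp add: coord_def smult_sum_right mult.assoc)
  \<comment> \<open>The binomial coefficient vanishes below \<open>n\<close> and the coefficient of \<open>F\<close> above its degree.\<close>
  also have "\<dots> = (\<Sum>k\<le>n + ?N. ?g k)"
    by (intro sum.mono_neutral_left) (auto simp: coeff_eq_0)
  also have "\<dots> = (\<Sum>k=n..n + ?N. ?g k)"
    by (intro sum.mono_neutral_right) auto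
  also have "\<dots> = (\<Sum>m\<le>?N. ?g (n + m))"
    by (rule sum.reindex_bij_witness[of _ "\<lambda>m. n + m" "\<lambda>k. k - n"]) auto
  also have "\<dots> = (\<Sum>m\<le>?N. smult (b ^ m / fact m) (coord F (n + m)))"
    by (intro sum.cong refl) (simp add: coord_def binomial_fact mult.commute)
  finally show ?thesis .
qed

lemma coord_translate2:
  "coord (translate2 c b F) n =
     pcompose (\<Sum>m\<le>degree F. smult (b ^ m / fact m) (coord F (n + m))) [:c, 1:]"
proof -
  have "coord (translate2 c b F) n = pcompose (coord (pcompose F [:[:b:], 1:]) n) [:c, 1:]"
    by (simp add: coord_def translate2_def coeff_map_poly pcompose_smult)
  then show ?thesis
    by (simp only: coord_pcompose_shift)
qed

lemma M_Gamma_recurrence: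
  assumes "F \<in> M_Gamma s a" and "s \<le> n"
  shows "coord F n = L_op s a (\<lambda>i. coord F (n - s + (i - 1)))"
  using assms by (simp add: M_Gamma_def)

lemma subspace_M_Gamma: "module.subspace scale2 (M_Gamma s a)"
proof -
  interpret vector_space scale2
    by (rule vector_space_scale2)
  have "coord 0 n = 0" and "coord (F + G) n = coord F n + coord G n"
    and "coord (scale2 c F) n = smult c (coord F n)" for F G n c
    by (simp_all add: coord_def scale2_def smult_add_right mult.commute)
  then show ?thesis
    by (simp add: subspace_def M_Gamma_def L_op_0 L_op_add L_op_smult)
qed

text \<open>
  The same recurrence at the index \<open>n + m\<close>, read as a statement about index \<open>n\<close>, says that the
  m-th left shift of the coordinate sequence is again a solution. The coordinates of a translate
  are a linear combination of such shifts followed by \<open>x \<mapsto> x + c\<close>, and \<open>L\<close> passes through both.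
\<close>

lemma translation_invariant_M_Gamma: "translation_invariant (M_Gamma s a)"
  unfolding translation_invariant_def
proof (intro ballI allI)
  fix F and c b :: complex assume F: "F \<in> M_Gamma s a"
  let ?w = "\<lambda>m. b ^ m / fact m"
  have "coord (translate2 c b F) n = L_op s a (\<lambda>i. coord (translate2 c b F) (n - s + (i - 1)))"
    if n: "s \<le> n" for n
  proof -
    have shift: "coord F (n + m) = L_op s a (\<lambda>i. coord F (n - s + (i - 1) + m))" for m
      using M_Gamma_recurrence[OF F, of "n + m"] n by (simp add: algebra_simps)
    show ?thesis
      by (simp only: coord_translate2 L_op_pcompose_shift L_op_sum L_op_smult shift)
  qed
  then show "translate2 c b F \<in> M_Gamma s a"
    by (simp add: M_Gamma_def)
qed

lemma M_Gamma_eq_0: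
  assumes F: "F \<in> M_Gamma s a" and initial: "\<And>n. n < s \<Longrightarrow> coord F n = 0"
  shows "F = 0"
proof -
  have "coord F n = 0" for n
  proof (induction n rule: less_induct)
    case (less n)
    show ?case
    proof (cases "n < s")
      case False
      then have "coord F n = L_op s a (\<lambda>i. coord F (n - s + (i - 1)))"
        by (intro M_Gamma_recurrence[OF F]) simp
      also have "\<dots> = L_op s a (\<lambda>i. 0)"
        using False by (intro L_op_cong less.IH) auto
      finally show ?thesis
        by (simp only: L_op_0)
    qed (rule initial)
  qed
  then show ?thesis
    by (intro poly_eqI) (simp add: coord_def)
qed

theorem lemma6:
  fixes s :: nat and a :: "nat \<Rightarrow> nat \<Rightarrow> complex"
  assumes "0 < s"
  shows "is_L_module s (M_Gamma s a)"
  unfolding is_L_module_def is_submodule_def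
  using subspace_M_Gamma translation_invariant_M_Gamma M_Gamma_eq_0 by blast

end
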